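(* Let $D\geq 1$ be an integer and let $A\subset\mathbb{R}^D$ be a finite set. Then the reduced graph $G_0=(V_0,E_0)$ of $A$ is connected.
   Context: A sign label is an element of $\{+,-\}^D$, i.e. a string of length $D$ over the alphabet $\{+,-\}$. For $v=(v^{(1)},\dots,v^{(D)})\in\mathbb{R}^D$, $h_v\in\{+,-\}^D$ denotes the sign label of $v$: its $k$-th symbol is $+$ if $v^{(k)}\geq 0$ and $-$ if $v^{(k)}<0$. For two sign labels $\phi,\psi$, the (so-called Levenshtein) distance $d_L(\phi,\psi)$ is defined here as the number of positions in which the two strings differ. The graph $P_D=(V,E)$ is the undirected graph with vertex set $V=\{+,-\}^D$ in which two sign labels $\phi_1,\phi_2$ are connected by an edge if and only if $d_L(\phi_1,\phi_2)=1$. The length of a path in $P_D$ is its number of edges; a minimal length path between two vertices is a path between them with the smallest possible number of edges. The reduced graph $G_0=(V_0,E_0)$ of a finite set $A\subset\mathbb{R}^D$ is the weighted undirected graph defined as follows. Its vertex set is $V_0=\{h_v \mid v\in A\}$. Two distinct sign labels $\phi_1,\phi_2\in V_0$ are connected by an edge in $E_0$ if and only if either $\{\phi_1,\phi_2\}\in E$, or the following condition holds: every minimal length path between $\phi_1$ and $\phi_2$ in $P_D$ contains no elements of $V_0$ other than its endpoints $\phi_1$ and $\phi_2$. The weight of the edge is $d_L(\phi_1,\phi_2)$ (weights play no role in connectedness). Connected means that any two vertices of $V_0$ are joined by a path in $G_0$. *)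

theory Defs
  imports
    "HOL-Analysis.Finite_Cartesian_Product"
    "Graph_Theory.Pair_Digraph"
    "Graph_Theory.Weighted_Graph"
begin

datatype sign_symbol = Plus | Minus

instance sign_symbol :: finite
proof
  have "(UNIV :: sign_symbol set) \<subseteq> {Plus, Minus}"
    using sign_symbol.exhaust by blast
  then show "finite (UNIV :: sign_symbol set)"
    by (rule finite_subset) simp
qed

text \<open>The positions \<open>1, \<dots>, D\<close> are the elements of the finite type \<^typ>\<open>'d\<close>, so \<open>D = CARD('d) \<ge> 1\<close>.\<close>

type_synonym 'd sign_label = "sign_symbol ^ 'd"

definition sign_label_of :: "real ^ 'd \<Rightarrow> 'd::finite sign_label" where
  "sign_label_of v = (\<chi> k. if v $ k \<ge> 0 then Plus else Minus)"

definition label_dist :: "'d::finite sign_label \<Rightarrow> 'd sign_label \<Rightarrow> nat" where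
  "label_dist \<phi> \<psi> = card {k. \<phi> $ k \<noteq> \<psi> $ k}"

text \<open>
  Undirected graphs are symmetric, loop-free pair digraphs (\<^locale>\<open>pair_graph\<close>). A path is given
  by its list of arcs, so that its number of edges is the length of that list.
\<close>

definition minimal_path :: "'a pair_pre_digraph \<Rightarrow> 'a \<Rightarrow> ('a \<times> 'a) awalk \<Rightarrow> 'a \<Rightarrow> bool" where
  "minimal_path G u p v \<longleftrightarrow> pre_digraph.apath (with_proj G) u p v \<and>
     (\<forall>q. pre_digraph.apath (with_proj G) u q v \<longrightarrow> length p \<le> length q)"

text \<open>
  Unlike \<open>connected\<close> of \<open>Graph_Theory.Digraph_Component\<close>, this does not require the vertex
  set to be nonempty.
\<close>

definition connected_graph :: "'a pair_pre_digraph \<Rightarrow> bool" where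
  "connected_graph G \<longleftrightarrow>
     (\<forall>u \<in> pverts G. \<forall>v \<in> pverts G. \<exists>p. pre_digraph.apath (with_proj G) u p v)"

definition label_graph :: "('d::finite sign_label) pair_pre_digraph" where
  "label_graph = \<lparr>pverts = UNIV, parcs = {(\<phi>, \<psi>). label_dist \<phi> \<psi> = 1}\<rparr>"

definition reduced_verts :: "(real ^ 'd) set \<Rightarrow> ('d::finite sign_label) set" where
  "reduced_verts A = {sign_label_of v | v. v \<in> A}"

definition reduced_graph :: "(real ^ 'd) set \<Rightarrow> ('d::finite sign_label) pair_pre_digraph" where
  "reduced_graph A =
     \<lparr>pverts = reduced_verts A,
      parcs = {(\<phi>, \<psi>). \<phi> \<in> reduced_verts A \<and> \<psi> \<in> reduced_verts A \<and> \<phi> \<noteq> \<psi> \<and>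
        ((\<phi>, \<psi>) \<in> parcs label_graph \<or>
         (\<forall>p. minimal_path label_graph \<phi> p \<psi> \<longrightarrow>
            set (pawalk_verts \<phi> p) \<inter> reduced_verts A \<subseteq> {\<phi>, \<psi>}))}\<rparr>"

text \<open>The edge weights of the reduced graph; connectedness does not depend on them.\<close>

definition reduced_weight :: "('d::finite sign_label \<times> 'd sign_label) weight_fun" where
  "reduced_weight = (\<lambda>(\<phi>, \<psi>). real (label_dist \<phi> \<psi>))"

text \<open>Both graphs are undirected and simple.\<close>

lemma label_dist_commute: "label_dist \<phi> \<psi> = label_dist \<psi> \<phi>"
  unfolding label_dist_def by (rule arg_cong[where f = card]) auto

lemma pair_graph_label_graph: "pair_graph (label_graph :: ('d::finite sign_label) pair_pre_digraph)"
proof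
  show "symmetric (with_proj (label_graph :: ('d sign_label) pair_pre_digraph))"
    by (auto simp: symmetric_def label_graph_def label_dist_commute intro!: symI)
qed (auto simp: label_graph_def label_dist_def)

lemma minimal_path_rev:
  assumes "pair_sym_digraph G"
  shows "minimal_path G v (rev_path p) u \<longleftrightarrow> minimal_path G u p v"
proof -
  interpret pair_sym_digraph G by fact
  have len: "length (rev_path q) = length q" for q :: "('a \<times> 'a) awalk"
    by (induction q) auto
  have "(\<forall>q. apath v q u \<longrightarrow> length p \<le> length q) \<longleftrightarrow> (\<forall>q. apath u q v \<longrightarrow> length p \<le> length q)"
    by (metis apath_rev_path len)
  then show ?thesis
    by (simp add: minimal_path_def len)
qed

lemma pair_graph_reduced_graph: "pair_graph (reduced_graph A)"
proof -
  interpret L: pair_graph "label_graph :: ('a sign_label) pair_pre_digraph"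
    by (rule pair_graph_label_graph)
  have rev: "set (pawalk_verts \<psi> p) \<inter> reduced_verts A \<subseteq> {\<psi>, \<phi>}"
    if all: "\<forall>p. minimal_path label_graph \<phi> p \<psi> \<longrightarrow>
          set (pawalk_verts \<phi> p) \<inter> reduced_verts A \<subseteq> {\<phi>, \<psi>}"
      and p: "minimal_path label_graph \<psi> p \<phi>" for \<phi> \<psi> :: "'a sign_label" and p
  proof -
    have "minimal_path label_graph \<phi> (rev_path p) \<psi>"
      using p by (simp add: minimal_path_rev L.pair_sym_digraph_axioms)
    moreover have "set (pawalk_verts \<phi> (rev_path p)) = set (pawalk_verts \<psi> p)"
      using p L.awalk_verts_rev_path[of \<psi> p \<phi>]
      by (simp add: minimal_path_def L.apath_def)
    ultimately show ?thesis
      using all by blast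
  qed
  have "sym (parcs (reduced_graph A))"
    using rev L.arcs_symmetric by (auto simp: reduced_graph_def intro!: symI)
  then show ?thesis
    by unfold_locales
      (auto simp: symmetric_def reduced_graph_def intro: finite_subset[OF subset_UNIV])
qed

end

theory Submission
  imports Defs
begin

text \<open>
  Only a general fact about shortest paths is needed: if a shortest path of \<open>P\<^sub>D\<close> between two
  vertices of \<open>V\<^sub>0\<close> passes through a third vertex of \<open>V\<^sub>0\<close>, that vertex is strictly closer to both
  endpoints, and induction on the length of a shortest path applies. Otherwise the endpoints are
  adjacent in \<open>G\<^sub>0\<close>.
\<close>

text \<open>Any walk can be cut at a vertex it visits, and the pieces of a walk without repeated
  vertices repeat none either.\<close>

lemma (in wf_digraph) apath_decomp:
  assumes p: "apath u p v" and w: "w \<in> set (awalk_verts u p)"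
  obtains q r where "p = q @ r" "apath u q w" "apath w r v"
proof -
  obtain q r where qr: "p = q @ r" "awalk u q w"
    using awalk_decomp[OF awalkI_apath[OF p] w] by blast
  moreover have "awlast u q = w"
    using qr(2) by (simp add: awalk_ends)
  ultimately show thesis
    using p that by (simp add: apath_append_iff)
qed

text \<open>Lengths are natural numbers, so some path attains the minimum; the bound by
  \<open>length q\<close> serves an induction on length.\<close>

lemma minimal_path_exists:
  assumes "pre_digraph.apath (with_proj G) u q v"
  obtains p where "minimal_path G u p v" "length p \<le> length q"
proof -
  define p where "p = arg_min length (\<lambda>p. pre_digraph.apath (with_proj G) u p v)"
  have "minimal_path G u p v"
    unfolding minimal_path_def p_def
    using arg_min_nat_lemma[of "\<lambda>p. pre_digraph.apath (with_proj G) u p v", OF assms] .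
  with assms that show thesis
    by (auto simp: minimal_path_def)
qed

lemma pverts_reduced_graph [simp]: "pverts (reduced_graph A) = reduced_verts A"
  by (simp add: reduced_graph_def)

text \<open>Reachability instead of adjacency also covers \<phi> = \<psi>, where the loop-free
  \<open>reduced_graph A\<close> has no arc.\<close>

lemma reachable_if_no_intermediate:
  assumes "\<phi> \<in> reduced_verts A" "\<psi> \<in> reduced_verts A"
    and "\<And>p. minimal_path label_graph \<phi> p \<psi> \<Longrightarrow>
      set (pawalk_verts \<phi> p) \<inter> reduced_verts A \<subseteq> {\<phi>, \<psi>}"
  shows "\<phi> \<rightarrow>\<^sup>*\<^bsub>with_proj (reduced_graph A)\<^esub> \<psi>"
proof -
  interpret R: pair_graph "reduced_graph A"
    by (rule pair_graph_reduced_graph)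
  show ?thesis
  proof (cases "\<phi> = \<psi>")
    case True
    then show ?thesis
      using assms(1) by simp
  next
    case False
    then have "(\<phi>, \<psi>) \<in> parcs (reduced_graph A)"
      using assms by (simp add: reduced_graph_def)
    then show ?thesis
      by (intro R.reachable_adjI) simp
  qed
qed

lemma reachable_if_minimal_path:
  assumes "\<phi> \<in> reduced_verts A" "\<psi> \<in> reduced_verts A" "minimal_path label_graph \<phi> p \<psi>"
  shows "\<phi> \<rightarrow>\<^sup>*\<^bsub>with_proj (reduced_graph A)\<^esub> \<psi>"
  using assms
proof (induction "length p" arbitrary: \<phi> \<psi> p rule: less_induct)
  case less
  interpret L: pair_graph "label_graph :: ('a sign_label) pair_pre_digraph"
    by (rule pair_graph_label_graph)
  interpret R: pair_graph "reduced_graph A"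
    by (rule pair_graph_reduced_graph)
  show ?case
  proof (cases "\<forall>q. minimal_path label_graph \<phi> q \<psi> \<longrightarrow>
      set (pawalk_verts \<phi> q) \<inter> reduced_verts A \<subseteq> {\<phi>, \<psi>}")
    case True
    then show ?thesis
      using less.prems(1,2) by (blast intro: reachable_if_no_intermediate)
  next
    case False
    then obtain q \<theta> where q: "minimal_path label_graph \<phi> q \<psi>"
      and \<theta>: "\<theta> \<in> set (pawalk_verts \<phi> q)" "\<theta> \<in> reduced_verts A" "\<theta> \<noteq> \<phi>" "\<theta> \<noteq> \<psi>"
      by blast
    obtain r s where rs: "q = r @ s" "L.apath \<phi> r \<theta>" "L.apath \<theta> s \<psi>"
      using q \<theta>(1) by (auto simp: minimal_path_def elim: L.apath_decomp)
    have "r \<noteq> []" "s \<noteq> []"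
      using rs(2,3) \<theta>(3,4) by (auto simp: L.apath_Nil_iff)
    \<comment> \<open>\<open>q\<close> witnesses the failure of the edge condition and may differ
      from \<open>p\<close>, but both are shortest paths between the same endpoints.\<close>
    moreover have "length q \<le> length p"
      using q less.prems(3) by (simp add: minimal_path_def)
    ultimately have len: "length r < length p" "length s < length p"
      unfolding rs(1) by (simp_all flip: length_greater_0_conv)
    \<comment> \<open>The induction hypothesis takes minimal paths, so \<open>r\<close> and
      \<open>s\<close> are replaced by minimal ones that are no longer.\<close>
    obtain r' where r': "minimal_path label_graph \<phi> r' \<theta>" "length r' \<le> length r"
      using minimal_path_exists[OF rs(2)] .
    obtain s' where s': "minimal_path label_graph \<theta> s' \<psi>" "length s' \<le> length s"
      using minimal_path_exists[OF rs(3)] .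
    have "\<phi> \<rightarrow>\<^sup>*\<^bsub>with_proj (reduced_graph A)\<^esub> \<theta>"
      using r' len(1) by (intro less.hyps[of r'] less.prems(1) \<theta>(2)) auto
    moreover have "\<theta> \<rightarrow>\<^sup>*\<^bsub>with_proj (reduced_graph A)\<^esub> \<psi>"
      using s' len(2) by (intro less.hyps[of s'] less.prems(2) \<theta>(2)) auto
    ultimately show ?thesis
      by (rule R.reachable_trans)
  qed
qed

theorem proposition2:
  fixes A :: "(real ^ 'd::finite) set"
  assumes "finite A"
  shows "connected_graph (reduced_graph A)"
proof -
  interpret R: pair_graph "reduced_graph A"
    by (rule pair_graph_reduced_graph)
  have "\<phi> \<rightarrow>\<^sup>*\<^bsub>with_proj (reduced_graph A)\<^esub> \<psi>"
    if V: "\<phi> \<in> reduced_verts A" "\<psi> \<in> reduced_verts A" for \<phi> \<psi>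
  proof (cases "\<exists>p. minimal_path label_graph \<phi> p \<psi>")
    case True
    then show ?thesis
      using V reachable_if_minimal_path by blast
  next
    \<comment> \<open>Vacuous, since \<open>P\<^sub>D\<close> is connected, but the definition of \<open>E\<^sub>0\<close> makes it unnecessary to prove that.\<close>
    case False
    then show ?thesis
      using V by (blast intro: reachable_if_no_intermediate)
  qed
  \<comment> \<open>\<open>connected_graph\<close> asks for a simple path; reachability yields one,
    since cycles can be cut out of a walk.\<close>
  then show ?thesis
    by (simp add: connected_graph_def R.reachable_apath[symmetric])
qed

end
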